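(* Let $\varepsilon,\tau>0$, let $A_1,A_2,B_1,B_2>0$, and let $F,\gamma_1,\gamma_2$ with constants $L_F,L_{\gamma_1},L_{\gamma_2}$, the mobilities $M_1,M_2(\cdot)$, the functions $f=F'$ and $g(\cdot)$, the operator $\mathcal T$ and the energy $W$ be as in the context. Let $(\psi^n,\varphi^n)$ satisfy $\partial_n\psi^n=\partial_n\varphi^n=0$ on $\partial\Omega$, and let $\varphi^{n+\frac12},\mu_\varphi^{n+\frac14},\psi^{n+1},\mu_\psi^{n+\frac12},\varphi^{n+1},\mu_\varphi^{n+\frac34}$ be obtained from $(\psi^n,\varphi^n)$ by the following three-step scheme in $\Omega$. Step 1: $$\frac{\varphi^{n+\frac12}-\varphi^n}{\tau/2}=\nabla\cdot\big(M_2(\psi^n)\nabla\mu_\varphi^{n+\frac14}\big),$$ $$\mu_\varphi^{n+\frac14}=-\varepsilon\nabla\cdot\Big(\gamma_2(\psi^n)\nabla\frac{\varphi^{n+\frac12}+\varphi^n}{2}\Big)+\frac1\varepsilon\gamma_2(\psi^n)\,\mathcal T[f](\varphi^n,\varphi^{n+\frac12};A_1,\tau)+g(\psi^n)\,\mathcal T[\gamma_1'](\varphi^n,\varphi^{n+\frac12};B_1,\tau).$$ Step 2: $$\frac{\psi^{n+1}-\psi^n}{\tau}=\nabla\cdot\big(M_1\nabla\mu_\psi^{n+\frac12}\big),$$ $$\mu_\psi^{n+\frac12}=-\varepsilon\nabla\cdot\Big(\gamma_1(\varphi^{n+\frac12})\nabla\frac{\psi^{n+1}+\psi^n}{2}\Big)+\frac1\varepsilon\gamma_1(\varphi^{n+\frac12})\,\mathcal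 T[f](\psi^n,\psi^{n+1};A_2,\tau)+g(\varphi^{n+\frac12})\,\mathcal T[\gamma_2'](\psi^n,\psi^{n+1};B_2,\tau).$$ Step 3: $$\frac{\varphi^{n+1}-\varphi^{n+\frac12}}{\tau/2}=\nabla\cdot\big(M_2(\psi^{n+1})\nabla\mu_\varphi^{n+\frac34}\big),$$ $$\mu_\varphi^{n+\frac34}=-\varepsilon\nabla\cdot\Big(\gamma_2(\psi^{n+1})\nabla\frac{\varphi^{n+1}+\varphi^{n+\frac12}}{2}\Big)+\frac1\varepsilon\gamma_2(\psi^{n+1})\,\mathcal T[f](\varphi^{n+\frac12},\varphi^{n+1};A_1,\tau)+g(\psi^{n+1})\,\mathcal T[\gamma_1'](\varphi^{n+\frac12},\varphi^{n+1};B_1,\tau).$$ The boundary conditions are $$\partial_n\varphi^{n+\frac12}=\partial_n\psi^{n+1}=\partial_n\varphi^{n+1}=\partial_n\mu_\varphi^{n+\frac14}=\partial_n\mu_\psi^{n+\frac12}=\partial_n\mu_\varphi^{n+\frac34}=0\quad\text{on }\partial\Omega.$$ If $$\tau\ge\max\Big\{\frac{L_F}{A_1},\frac{L_{\gamma_1}}{B_1},\frac{L_F}{A_2},\frac{L_{\gamma_2}}{B_2}\Big\},$$ then the scheme is energy stable, and the following discrete energy law holds: $$W(\psi^{n+1},\varphi^{n+1})-W(\psi^n,\varphi^n)\le-\frac\tau2\int_\Omega M_2(\psi^n)|\nabla\mu_\varphi^{n+\frac14}|^2\,d\mathbf x-\tau\int_\Omega M_1|\nabla\mu_\psi^{n+\frac12}|^2\,d\mathbf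 x-\frac\tau2\int_\Omega M_2(\psi^{n+1})|\nabla\mu_\varphi^{n+\frac34}|^2\,d\mathbf x.$$
   Context: $\Omega\subset\mathbb R^d$ ($d=2,3$) is a bounded domain regular enough for the divergence theorem, with outward normal derivative $\partial_n$ on $\partial\Omega$. All functions in the scheme ($\psi^n,\varphi^n,\varphi^{n+1/2},\psi^{n+1},\varphi^{n+1}$ and the three $\mu$'s) are real-valued functions on $\overline\Omega$, regular enough (e.g. $C^2(\overline\Omega)$) for the equations to hold classically and for integration by parts. "Energy stable" means $W(\psi^{n+1},\varphi^{n+1})\le W(\psi^n,\varphi^n)$. Mobilities: $M_1=m_1$ and $M_2(\psi)=m_2\big(\frac{1+\psi}{2}\big)^{2a}$, with constants $m_1,m_2>0$ and a positive integer $a$. Nonlinearities: the model functions are $F(z)=\frac14(z^2-1)^2$ and, for given surface tension coefficients $\sigma_{12},\sigma_{13},\sigma_{23}>0$ and $\alpha=3+\varepsilon$, $$\gamma_1(\varphi)=\tfrac{3}{2\sqrt2}\Big(\sigma_{12}\big(\tfrac{1-\varphi}{2}\big)^2(2+\varphi)+\sigma_{13}\big(\tfrac{1+\varphi}{2}\big)^2(2-\varphi)+\tfrac{\alpha}{16}|\sigma_{12}-\sigma_{13}|(1-\varphi^2)^2\Big),$$ $$\gamma_2(\psi)=\tfrac{3}{2\sqrt2}\Big(\sigma_{23}\big(\tfrac{1+\psi}{2}\big)^2(2-\psi)+\tfrac{\alpha}{16}\sigma_{23}(1-\psi^2)^2\Big).$$ In the scheme and in $W$, $F,\gamma_1,\gamma_2$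 denote regularized versions of these: nonnegative $C^2$ functions $\mathbb R\to\mathbb R$ that coincide with the formulas above on $[-1,1]$ and are modified outside $[-1,1]$ so that there are constants $L_F,L_{\gamma_1},L_{\gamma_2}$ with $$\max_{z\in\mathbb R}|F''(z)|\le L_F,\quad\max_{\varphi\in\mathbb R}|\gamma_1''(\varphi)|\le L_{\gamma_1},\quad\max_{\psi\in\mathbb R}|\gamma_2''(\psi)|\le L_{\gamma_2}.$$ Put $f=F'$ and, for a function $u$ on $\Omega$, $g(u)=\frac\varepsilon2|\nabla u|^2+\frac1\varepsilon F(u)$. For a $C^1$ function $q:\mathbb R\to\mathbb R$ and a constant $A$, $$\mathcal T[q](u,v;A,\tau)=q(u)+\tfrac12q'(u)(v-u)+A\tau(v-u).$$ Energy: $$W(\psi,\varphi)=\int_\Omega\gamma_1(\varphi)\Big(\frac\varepsilon2|\nabla\psi|^2+\frac1\varepsilon F(\psi)\Big)+\gamma_2(\psi)\Big(\frac\varepsilon2|\nabla\varphi|^2+\frac1\varepsilon F(\varphi)\Big)\,d\mathbf x.$$ *)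

theory Defs
  imports "HOL-Analysis.Analysis"
begin

definition grad :: "('a::euclidean_space \<Rightarrow> real) \<Rightarrow> 'a \<Rightarrow> 'a" where
  "grad u x = (THE D. GDERIV u x :> D)"

definition divergence :: "('a::euclidean_space \<Rightarrow> 'a) \<Rightarrow> 'a \<Rightarrow> real" where
  "divergence X x = (\<Sum>b\<in>Basis. frechet_derivative X (at x) b \<bullet> b)"

text \<open>
  Functions live on \<open>closure \<Omega>\<close> but are total in HOL; values outside \<open>closure \<Omega>\<close> play no role.
  As usual, \<open>C\<^sup>1\<close> on the closure means that the derivative, which exists in the open set \<open>\<Omega>\<close>,
  extends continuously to \<open>closure \<Omega>\<close>.
\<close>

definition C1_closure :: "'a::euclidean_space set \<Rightarrow> ('a \<Rightarrow> 'b::real_normed_vector) \<Rightarrow> bool" where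
  "C1_closure \<Omega> f \<longleftrightarrow> continuous_on (closure \<Omega>) f \<and>
     (\<exists>D :: 'a \<Rightarrow> 'a \<Rightarrow>\<^sub>L 'b. continuous_on (closure \<Omega>) D \<and>
        (\<forall>x\<in>\<Omega>. (f has_derivative blinfun_apply (D x)) (at x)))"

definition C2_closure :: "'a::euclidean_space set \<Rightarrow> ('a \<Rightarrow> real) \<Rightarrow> bool" where
  "C2_closure \<Omega> u \<longleftrightarrow> C1_closure \<Omega> u \<and>
     (\<exists>G. C1_closure \<Omega> G \<and> (\<forall>x\<in>\<Omega>. G x = grad u x))"

text \<open>
  The unit vector \<open>n\<close> is the outward normal to \<open>\<Omega>\<close> at \<open>x\<close> if near \<open>x\<close>, outside arbitrarily thin conical
  neighbourhoods of the hyperplane through \<open>x\<close> orthogonal to \<open>n\<close>, the set \<open>\<Omega>\<close> coincides with the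
  half-space \<open>(y - x) \<bullet> n < 0\<close>.  There is at most one such \<open>n\<close>; it exists at every boundary point
  of a \<open>C\<^sup>1\<close> domain and at almost every boundary point of a Lipschitz domain.
\<close>

definition outward_unit_normal :: "'a::euclidean_space set \<Rightarrow> 'a \<Rightarrow> 'a \<Rightarrow> bool" where
  "outward_unit_normal \<Omega> x n \<longleftrightarrow> norm n = 1 \<and>
     (\<forall>c>0. \<exists>r>0. \<forall>y\<in>ball x r.
        ((y - x) \<bullet> n < - c * norm (y - x) \<longrightarrow> y \<in> \<Omega>) \<and>
        ((y - x) \<bullet> n > c * norm (y - x) \<longrightarrow> y \<notin> \<Omega>))"

text \<open>On the boundary the gradient is the limit of the gradient from inside \<open>\<Omega>\<close>.\<close>

definition normal_derivative ::
    "'a::euclidean_space set \<Rightarrow> ('a \<Rightarrow> real) \<Rightarrow> 'a \<Rightarrow> 'a \<Rightarrow> real" where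
  "normal_derivative \<Omega> u x n = Lim (at x within \<Omega>) (grad u) \<bullet> n"

text \<open>\<open>\<partial>\<^sub>n u = 0\<close> at every boundary point at which there is a normal (so corners are allowed).\<close>

definition neumann :: "'a::euclidean_space set \<Rightarrow> ('a \<Rightarrow> real) \<Rightarrow> bool" where
  "neumann \<Omega> u \<longleftrightarrow>
     (\<forall>x\<in>frontier \<Omega>. \<forall>n. outward_unit_normal \<Omega> x n \<longrightarrow> normal_derivative \<Omega> u x n = 0)"

text \<open>
  A bounded domain regular enough for the divergence theorem: the outward normal exists almost
  everywhere with respect to a finite surface measure \<open>S\<close> on the boundary for which the
  divergence theorem holds.  Since the normal is unique and of length one, the divergence theorem
  determines \<open>S\<close>: the vector measure \<open>\<nu> S\<close> is determined by its values on \<open>C\<^sup>1\<close> fields and \<open>S\<close> is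
  its total variation.
\<close>

definition divergence_domain :: "'a::euclidean_space set \<Rightarrow> bool" where
  "divergence_domain \<Omega> \<longleftrightarrow>
     open \<Omega> \<and> connected \<Omega> \<and> \<Omega> \<noteq> {} \<and> bounded \<Omega> \<and>
     (\<exists>(S :: 'a measure) (\<nu> :: 'a \<Rightarrow> 'a).
        finite_measure S \<and> sets S = sets (restrict_space borel (frontier \<Omega>)) \<and>
        \<nu> \<in> borel_measurable S \<and> (AE x in S. outward_unit_normal \<Omega> x (\<nu> x)) \<and>
        (\<forall>X :: 'a \<Rightarrow> 'a. C1_closure \<Omega> X \<longrightarrow>
           (LINT x:\<Omega>|lborel. divergence X x) = (LINT x|S. X x \<bullet> \<nu> x)))"

definition F_model :: "real \<Rightarrow> real" where
  "F_model z = 1/4 * (z^2 - 1)^2"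

definition gamma1_model :: "real \<Rightarrow> real \<Rightarrow> real \<Rightarrow> real \<Rightarrow> real" where
  "gamma1_model \<epsilon> \<sigma>12 \<sigma>13 z = (let \<alpha> = 3 + \<epsilon> in
     3 / (2 * sqrt 2) *
       (\<sigma>12 * ((1 - z) / 2)^2 * (2 + z) + \<sigma>13 * ((1 + z) / 2)^2 * (2 - z)
        + \<alpha> / 16 * \<bar>\<sigma>12 - \<sigma>13\<bar> * (1 - z^2)^2))"

definition gamma2_model :: "real \<Rightarrow> real \<Rightarrow> real \<Rightarrow> real" where
  "gamma2_model \<epsilon> \<sigma>23 z = (let \<alpha> = 3 + \<epsilon> in
     3 / (2 * sqrt 2) *
       (\<sigma>23 * ((1 + z) / 2)^2 * (2 - z) + \<alpha> / 16 * \<sigma>23 * (1 - z^2)^2))"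

definition C2_real :: "(real \<Rightarrow> real) \<Rightarrow> bool" where
  "C2_real q \<longleftrightarrow> q differentiable_on UNIV \<and> deriv q differentiable_on UNIV \<and>
     continuous_on UNIV (deriv (deriv q))"

definition regularization :: "(real \<Rightarrow> real) \<Rightarrow> (real \<Rightarrow> real) \<Rightarrow> real \<Rightarrow> bool" where
  "regularization q0 q L \<longleftrightarrow> C2_real q \<and> (\<forall>z. 0 \<le> q z) \<and> (\<forall>z\<in>{-1..1}. q z = q0 z) \<and>
     (\<forall>z. \<bar>deriv (deriv q) z\<bar> \<le> L)"

definition M2 :: "real \<Rightarrow> nat \<Rightarrow> real \<Rightarrow> real" where
  "M2 m2 a s = m2 * ((1 + s) / 2) ^ (2 * a)"

definition T_op :: "(real \<Rightarrow> real) \<Rightarrow> real \<Rightarrow> real \<Rightarrow> real \<Rightarrow> real \<Rightarrow> real" where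
  "T_op q u v A \<tau> = q u + 1/2 * deriv q u * (v - u) + A * \<tau> * (v - u)"

definition g_dens ::
    "real \<Rightarrow> (real \<Rightarrow> real) \<Rightarrow> ('a::euclidean_space \<Rightarrow> real) \<Rightarrow> 'a \<Rightarrow> real" where
  "g_dens \<epsilon> F u x = \<epsilon> / 2 * (norm (grad u x))^2 + 1 / \<epsilon> * F (u x)"

definition W_energy ::
    "'a::euclidean_space set \<Rightarrow> real \<Rightarrow> (real \<Rightarrow> real) \<Rightarrow> (real \<Rightarrow> real) \<Rightarrow> (real \<Rightarrow> real) \<Rightarrow>
     ('a \<Rightarrow> real) \<Rightarrow> ('a \<Rightarrow> real) \<Rightarrow> real" where
  "W_energy \<Omega> \<epsilon> F \<gamma>1 \<gamma>2 \<psi> \<phi> =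
     (LINT x:\<Omega>|lborel.
        \<gamma>1 (\<phi> x) * (\<epsilon> / 2 * (norm (grad \<psi> x))^2 + 1 / \<epsilon> * F (\<psi> x))
      + \<gamma>2 (\<psi> x) * (\<epsilon> / 2 * (norm (grad \<phi> x))^2 + 1 / \<epsilon> * F (\<phi> x)))"

end

theory Submission
  imports Defs
begin

text \<open>
  The scheme splits the step into three substeps, each freezing one of the two phase fields.
  Testing the evolution equation of a substep with \<open>\<mu>\<close> and the equation for \<open>\<mu>\<close> with the
  increment, and integrating by parts, leaves the dissipation on one side; the midpoint rule makes
  the gradient terms telescope exactly, while a Taylor expansion with \<open>\<tau>\<close> large compared with the
  second derivatives shows that \<open>\<T>[q']\<close> times the increment dominates the increment of \<open>q\<close>.
  Interchanging the roles of \<open>(\<psi>, \<gamma>\<^sub>1)\<close> and \<open>(\<phi>, \<gamma>\<^sub>2)\<close> leaves the energy invariant, so one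
  estimate covers all three substeps.
\<close>

section \<open>Calculus of functions that are C^1 up to the boundary\<close>

lemma C1_closure_continuous: "C1_closure \<Omega> f \<Longrightarrow> continuous_on (closure \<Omega>) f"
  by (simp add: C1_closure_def)

lemma C1_closure_differentiable:
  "C1_closure \<Omega> f \<Longrightarrow> x \<in> \<Omega> \<Longrightarrow> f differentiable (at x)"
  by (auto simp: C1_closure_def differentiable_def)

lemma C1_closure_const: "C1_closure \<Omega> (\<lambda>x. c)"
  unfolding C1_closure_def by (auto intro!: exI[of _ "\<lambda>x. 0"] simp: zero_blinfun.rep_eq)

lemma C1_closure_add:
  assumes "C1_closure \<Omega> f" "C1_closure \<Omega> g"
  shows "C1_closure \<Omega> (\<lambda>x. f x + g x)"
proof -
  obtain Df Dg where D: "continuous_on (closure \<Omega>) Df" "continuous_on (closure \<Omega>) Dg"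
    "\<And>x. x \<in> \<Omega> \<Longrightarrow> (f has_derivative blinfun_apply (Df x)) (at x)"
    "\<And>x. x \<in> \<Omega> \<Longrightarrow> (g has_derivative blinfun_apply (Dg x)) (at x)"
    using assms unfolding C1_closure_def by blast
  have "((\<lambda>x. f x + g x) has_derivative blinfun_apply (Df x + Dg x)) (at x)" if "x \<in> \<Omega>" for x
    using has_derivative_add[OF D(3)[OF that] D(4)[OF that]] by (simp add: plus_blinfun.rep_eq)
  moreover have "continuous_on (closure \<Omega>) (\<lambda>x. f x + g x)" "continuous_on (closure \<Omega>) (\<lambda>x. Df x + Dg x)"
    using assms[THEN C1_closure_continuous] D(1,2) by (auto intro: continuous_on_add)
  ultimately show ?thesis
    unfolding C1_closure_def by blast
qed

lemma C1_closure_scaleR: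
  fixes g :: "'a::euclidean_space \<Rightarrow> 'b::real_normed_vector"
  assumes "C1_closure \<Omega> f" "C1_closure \<Omega> g"
  shows "C1_closure \<Omega> (\<lambda>x. f x *\<^sub>R g x)"
proof -
  obtain Df Dg where D: "continuous_on (closure \<Omega>) Df" "continuous_on (closure \<Omega>) Dg"
    "\<And>x. x \<in> \<Omega> \<Longrightarrow> (f has_derivative blinfun_apply (Df x)) (at x)"
    "\<And>x. x \<in> \<Omega> \<Longrightarrow> (g has_derivative blinfun_apply (Dg x)) (at x)"
    using assms unfolding C1_closure_def by blast
  \<comment> \<open>The product rule in operator form. Since
    \<open>blinfun_scaleR_left (g x)\<close> sends a scalar r to r g(x), its composition with
    \<open>Df x\<close> is the term in which f is differentiated; written this way, continuity in x
    follows from that of the factors.\<close>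
  define E where "E x = f x *\<^sub>R Dg x + (blinfun_scaleR_left (g x) o\<^sub>L Df x)" for x
  have "continuous_on (closure \<Omega>) E"
    unfolding E_def using assms[THEN C1_closure_continuous] D(1,2)
    by (intro continuous_on_add continuous_on_scaleR
        bounded_bilinear.continuous_on[OF bounded_bilinear_blinfun_compose
          bounded_linear.continuous_on[OF bounded_linear_blinfun_scaleR_left]])
  moreover have "((\<lambda>x. f x *\<^sub>R g x) has_derivative blinfun_apply (E x)) (at x)" if "x \<in> \<Omega>" for x
    using has_derivative_scaleR[OF D(3)[OF that] D(4)[OF that]]
    by (simp add: E_def plus_blinfun.rep_eq scaleR_blinfun.rep_eq)
  moreover have "continuous_on (closure \<Omega>) (\<lambda>x. f x *\<^sub>R g x)"
    using assms[THEN C1_closure_continuous] by (intro continuous_on_scaleR)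
  ultimately show ?thesis
    unfolding C1_closure_def by blast
qed

lemma C1_closure_compose_real:
  assumes u: "C1_closure \<Omega> u"
    and q: "\<And>s. (q has_real_derivative q' s) (at s)" and q': "continuous_on UNIV q'"
  shows "C1_closure \<Omega> (\<lambda>x. q (u x))"
proof -
  obtain D where D: "continuous_on (closure \<Omega>) D"
    "\<And>x. x \<in> \<Omega> \<Longrightarrow> (u has_derivative blinfun_apply (D x)) (at x)"
    using u unfolding C1_closure_def by blast
  have "continuous_on UNIV q"
    using q by (intro continuous_at_imp_continuous_on) (blast intro: DERIV_isCont)
  then have cont: "continuous_on (closure \<Omega>) (\<lambda>x. q (u x))"
      "continuous_on (closure \<Omega>) (\<lambda>x. q' (u x))"
    using continuous_on_compose2[OF _ C1_closure_continuous[OF u]] q' by auto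
  have "((\<lambda>x. q (u x)) has_derivative blinfun_apply (q' (u x) *\<^sub>R D x)) (at x)" if "x \<in> \<Omega>" for x
    using has_derivative_compose[OF D(2)[OF that] q[of "u x", unfolded has_field_derivative_def]]
    by (simp add: scaleR_blinfun.rep_eq)
  then show ?thesis
    unfolding C1_closure_def using cont(1) continuous_on_scaleR[OF cont(2) D(1)] by blast
qed

section \<open>Gradients, their continuous extensions and the Neumann condition\<close>

lemma gderiv_grad_eq:
  assumes "GDERIV u x :> D"
  shows "grad u x = D"
  unfolding grad_def
proof (rule the_equality)
  show "E = D" if "GDERIV u x :> E" for E
  proof -
    have "(\<lambda>h. h \<bullet> E) = (\<lambda>h. h \<bullet> D)"
      using that assms unfolding gderiv_def by (rule has_derivative_unique)
    then show ?thesis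
      by (metis vector_eq_ldot)
  qed
qed (fact assms)

lemma C1_closure_gderiv:
  assumes "C1_closure \<Omega> u" "x \<in> \<Omega>"
  shows "GDERIV u x :> grad u x"
proof -
  obtain D :: "'a \<Rightarrow>\<^sub>L real" where D: "(u has_derivative blinfun_apply D) (at x)"
    using assms unfolding C1_closure_def by blast
  \<comment> \<open>Riesz representation in coordinates: the gradient has the values of the
    derivative on \<open>Basis\<close> as its components.\<close>
  have "blinfun_apply D h = h \<bullet> (\<Sum>b\<in>Basis. D b *\<^sub>R b)" for h
  proof -
    have "blinfun_apply D h = D (\<Sum>b\<in>Basis. (h \<bullet> b) *\<^sub>R b)"
      by (simp add: euclidean_representation)
    then show ?thesis
      by (simp add: blinfun.sum_right blinfun.scaleR_right inner_sum_right mult.commute)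
  qed
  then have "blinfun_apply D = (\<lambda>h. h \<bullet> (\<Sum>b\<in>Basis. D b *\<^sub>R b))"
    by (rule ext)
  with D have "GDERIV u x :> (\<Sum>b\<in>Basis. D b *\<^sub>R b)"
    unfolding gderiv_def by (rule back_subst)
  then show ?thesis
    by (simp add: gderiv_grad_eq)
qed

lemma gderiv_imp_C1_closure:
  assumes "continuous_on (closure \<Omega>) u" "continuous_on (closure \<Omega>) H"
    and "\<And>x. x \<in> \<Omega> \<Longrightarrow> GDERIV u x :> H x"
  shows "C1_closure \<Omega> u"
  unfolding C1_closure_def
  using assms
  by (intro conjI exI[of _ "\<lambda>x. blinfun_inner_left (H x)"])
    (auto simp: gderiv_def intro!: bounded_linear.continuous_on[OF bounded_linear_blinfun_inner_left])

text \<open>On the frontier \<open>grad u\<close> would depend on values of \<open>u\<close> outside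
  the closure. The field \<open>G\<close> is the continuous extension of the gradient from inside,
  so the Neumann condition becomes a pointwise statement without limits, ready for the boundary
  integral.\<close>

definition neumann_gradient ::
    "'a::euclidean_space set \<Rightarrow> ('a \<Rightarrow> real) \<Rightarrow> ('a \<Rightarrow> 'a) \<Rightarrow> bool" where
  "neumann_gradient \<Omega> u G \<longleftrightarrow> C1_closure \<Omega> u \<and> C1_closure \<Omega> G \<and> (\<forall>x\<in>\<Omega>. GDERIV u x :> G x) \<and>
     (\<forall>x\<in>frontier \<Omega>. \<forall>n. outward_unit_normal \<Omega> x n \<longrightarrow> G x \<bullet> n = 0)"

text \<open>The extension supplied by \<open>C2_closure\<close> is the limit of
  \<open>grad u\<close> at each boundary point, hence it is the value that \<open>Lim\<close> takes
  in \<open>normal_derivative\<close>.\<close>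

lemma neumann_gradient_exists:
  assumes "open \<Omega>" "C2_closure \<Omega> u" "neumann \<Omega> u"
  obtains G where "neumann_gradient \<Omega> u G"
proof -
  obtain G where u: "C1_closure \<Omega> u" and G: "C1_closure \<Omega> G" "\<And>x. x \<in> \<Omega> \<Longrightarrow> G x = grad u x"
    using assms(2) unfolding C2_closure_def by blast
  have "G x \<bullet> n = 0" if x: "x \<in> frontier \<Omega>" and n: "outward_unit_normal \<Omega> x n" for x n
  proof -
    \<comment> \<open>A frontier point of an open set lies in the closure but not in the set, so it
      is a limit point; on the trivial filter \<open>Lim\<close> would not determine a
      value.\<close>
    have x': "x \<in> closure \<Omega>" "x \<notin> \<Omega>"
      using x \<open>open \<Omega>\<close> by (auto simp: frontier_def interior_open)
    then have nontriv: "at x within \<Omega> \<noteq> bot"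
      by (metis closure_def UnE mem_Collect_eq trivial_limit_within)
    have "(G \<longlongrightarrow> G x) (at x within \<Omega>)"
      using C1_closure_continuous[OF G(1)] x'(1) closure_subset
      by (metis continuous_on_def tendsto_within_subset)
    moreover have "\<forall>\<^sub>F y in at x within \<Omega>. G y = grad u y"
      by (auto simp: eventually_at_topological G(2))
    ultimately have "(grad u \<longlongrightarrow> G x) (at x within \<Omega>)"
      using tendsto_cong by blast
    then have "Lim (at x within \<Omega>) (grad u) = G x"
      by (rule tendsto_Lim[OF nontriv])
    then show ?thesis
      using assms(3) x n by (auto simp: neumann_def normal_derivative_def)
  qed
  then show thesis
    using that[of G] u G C1_closure_gderiv[OF u] by (simp add: neumann_gradient_def)
qed

text \<open>Serves the midpoint of old and new field, on which the divergence term of each potential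
  acts.\<close>

lemma neumann_gradient_average:
  assumes "neumann_gradient \<Omega> u G" "neumann_gradient \<Omega> v H"
  shows "neumann_gradient \<Omega> (\<lambda>x. (u x + v x) / 2) (\<lambda>x. (1 / 2) *\<^sub>R (G x + H x))"
proof -
  have "C1_closure \<Omega> (\<lambda>x. (1 / 2) *\<^sub>R (u x + v x))" "C1_closure \<Omega> (\<lambda>x. (1 / 2) *\<^sub>R (G x + H x))"
    using assms unfolding neumann_gradient_def
    by (intro C1_closure_scaleR C1_closure_add C1_closure_const; simp)+
  moreover have "GDERIV (\<lambda>x. (u x + v x) / 2) x :> (1 / 2) *\<^sub>R (G x + H x)" if "x \<in> \<Omega>" for x
    using assms that unfolding neumann_gradient_def gderiv_def
    by (auto intro!: derivative_eq_intros simp: fun_eq_iff inner_add_right)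
  ultimately show ?thesis
    using assms by (auto simp: neumann_gradient_def inner_add_left)
qed

section \<open>Integrability, divergence and integration by parts\<close>

lemma set_integrable_continuous_closure:
  fixes f :: "'a::euclidean_space \<Rightarrow> real"
  assumes "open \<Omega>" "bounded \<Omega>" "continuous_on (closure \<Omega>) d" "\<And>x. x \<in> \<Omega> \<Longrightarrow> f x = d x"
  shows "set_integrable lborel \<Omega> f"
proof -
  \<comment> \<open>The closure is compact, so the continuous \<open>d\<close> is integrable there
    and then on \<Omega>. The function \<open>f\<close>, for instance an expression in
    \<open>grad\<close>, is controlled only on \<Omega>.\<close>
  have "set_integrable lborel (closure \<Omega>) d"
    unfolding set_integrable_def
    using borel_integrable_compact[of "closure \<Omega>" d] assms
    by (simp add: compact_closure indicator_scaleR_eq_if)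
  then have "set_integrable lborel \<Omega> d"
    by (rule set_integrable_subset) (use assms closure_subset in auto)
  then show ?thesis
    using assms(4) by (simp cong: set_integrable_cong)
qed

text \<open>Derivatives at a point of an open set see only values in that set. This allows
  \<open>grad s\<close> to be replaced by its extension under a divergence.\<close>

lemma divergence_cong:
  assumes "open \<Omega>" "x \<in> \<Omega>" "\<And>y. y \<in> \<Omega> \<Longrightarrow> X y = Y y"
  shows "divergence X x = divergence Y x"
proof -
  have "(X has_derivative D) (at x) \<longleftrightarrow> (Y has_derivative D) (at x)" for D
    using has_derivative_transform_within_open[OF _ assms(1,2)] assms(3) by (auto simp: eq_commute)
  then show ?thesis
    by (simp add: divergence_def frechet_derivative_def)
qed

text \<open>The trace over \<open>Basis\<close> of the product rule: the rank-one part k -> (k . H)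
  Y(x) of the derivative has trace H . Y(x).\<close>

lemma divergence_scaleR:
  assumes "GDERIV h x :> H" "Y differentiable (at x)"
  shows "divergence (\<lambda>y. h y *\<^sub>R Y y) x = h x * divergence Y x + H \<bullet> Y x"
proof -
  define D where "D = frechet_derivative Y (at x)"
  have D: "(Y has_derivative D) (at x)"
    using assms(2) by (simp add: D_def frechet_derivative_works)
  have "((\<lambda>y. h y *\<^sub>R Y y) has_derivative (\<lambda>k. h x *\<^sub>R D k + (k \<bullet> H) *\<^sub>R Y x)) (at x)"
    using has_derivative_scaleR[OF assms(1)[unfolded gderiv_def] D] by simp
  then have "frechet_derivative (\<lambda>y. h y *\<^sub>R Y y) (at x) = (\<lambda>k. h x *\<^sub>R D k + (k \<bullet> H) *\<^sub>R Y x)"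
    by (rule frechet_derivative_at[symmetric])
  then show ?thesis
    unfolding divergence_def D_def[symmetric] euclidean_inner[of H "Y x"]
    by (simp add: inner_add_left sum.distrib sum_distrib_left inner_commute[of H]
        inner_commute[of "Y x"])
qed

lemma C1_closure_divergence_extends:
  assumes "C1_closure \<Omega> Y"
  obtains d where "continuous_on (closure \<Omega>) d" "\<And>x. x \<in> \<Omega> \<Longrightarrow> divergence Y x = d x"
proof -
  obtain D where D: "continuous_on (closure \<Omega>) D"
    "\<And>x. x \<in> \<Omega> \<Longrightarrow> (Y has_derivative blinfun_apply (D x)) (at x)"
    using assms unfolding C1_closure_def by blast
  show thesis
  proof
    show "continuous_on (closure \<Omega>) (\<lambda>x. \<Sum>b\<in>Basis. D x b \<bullet> b)"
      using D(1) by (intro continuous_intros)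
    show "divergence Y x = (\<Sum>b\<in>Basis. D x b \<bullet> b)" if "x \<in> \<Omega>" for x
      using frechet_derivative_at[OF D(2)[OF that]] by (simp add: divergence_def)
  qed
qed

text \<open>The divergence theorem for the field h k G, whose normal component vanishes almost
  everywhere on the boundary because of G. The test function h needs no boundary condition.
  Integrability is stated too, since the integrals are later split into sums.\<close>

lemma green_neumann:
  assumes dom: "divergence_domain \<Omega>"
    and h: "C1_closure \<Omega> h" and H: "continuous_on (closure \<Omega>) H"
    and hH: "\<And>x. x \<in> \<Omega> \<Longrightarrow> GDERIV h x :> H x"
    and k: "C1_closure \<Omega> k" and s: "neumann_gradient \<Omega> s G"
  shows "set_integrable lborel \<Omega> (\<lambda>x. h x * divergence (\<lambda>y. k y *\<^sub>R grad s y) x)"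
    and "(LINT x:\<Omega>|lborel. h x * divergence (\<lambda>y. k y *\<^sub>R grad s y) x)
       = - (LINT x:\<Omega>|lborel. k x * (H x \<bullet> G x))"
proof -
  have "open \<Omega>" "bounded \<Omega>"
    using dom by (auto simp: divergence_domain_def)
  obtain S \<nu> where S: "sets S = sets (restrict_space borel (frontier \<Omega>))"
      "AE x in S. outward_unit_normal \<Omega> x (\<nu> x)"
      "\<And>X. C1_closure \<Omega> X \<Longrightarrow> (LINT x:\<Omega>|lborel. divergence X x) = (LINT x|S. X x \<bullet> \<nu> x)"
    using dom unfolding divergence_domain_def by blast
  have spaceS: "space S = frontier \<Omega>"
    using sets_eq_imp_space_eq[OF S(1)] by (simp add: space_restrict_space)
  \<comment> \<open>Built from the extension \<open>G\<close> instead of \<open>grad s\<close>, so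
    that the field is C^1 up to the boundary and has the right boundary values.\<close>
  define Y where "Y = (\<lambda>x. k x *\<^sub>R G x)"
  have Y: "C1_closure \<Omega> Y"
    using s k unfolding Y_def neumann_gradient_def by (blast intro: C1_closure_scaleR)
  have div_eq: "divergence (\<lambda>y. k y *\<^sub>R grad s y) x = divergence Y x" if "x \<in> \<Omega>" for x
    using s by (intro divergence_cong[OF \<open>open \<Omega>\<close> that])
      (auto simp: Y_def neumann_gradient_def gderiv_grad_eq)
  obtain d where d: "continuous_on (closure \<Omega>) d" "\<And>x. x \<in> \<Omega> \<Longrightarrow> divergence Y x = d x"
    using C1_closure_divergence_extends[OF Y] by blast
  have "continuous_on (closure \<Omega>) (\<lambda>x. h x * d x)"
    using C1_closure_continuous[OF h] d by (intro continuous_intros)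
  then show int: "set_integrable lborel \<Omega> (\<lambda>x. h x * divergence (\<lambda>y. k y *\<^sub>R grad s y) x)"
    by (rule set_integrable_continuous_closure[OF \<open>open \<Omega>\<close> \<open>bounded \<Omega>\<close>]) (simp add: d div_eq)
  have "continuous_on (closure \<Omega>) (\<lambda>x. H x \<bullet> Y x)"
    using C1_closure_continuous[OF Y] H by (intro continuous_intros)
  then have int': "set_integrable lborel \<Omega> (\<lambda>x. H x \<bullet> Y x)"
    by (rule set_integrable_continuous_closure[OF \<open>open \<Omega>\<close> \<open>bounded \<Omega>\<close>]) simp
  \<comment> \<open>The normal exists at almost every boundary point, and there \<open>G\<close> is
    orthogonal to it; \<open>AE_space\<close> places the point on the frontier.\<close>
  have "AE x in S. (h x *\<^sub>R Y x) \<bullet> \<nu> x = 0"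
    using S(2) AE_space
    by eventually_elim (use s in \<open>simp add: spaceS Y_def neumann_gradient_def\<close>)
  then have "0 = (LINT x|S. (h x *\<^sub>R Y x) \<bullet> \<nu> x)"
    by (simp add: integral_eq_zero_AE)
  also have "\<dots> = (LINT x:\<Omega>|lborel. divergence (\<lambda>x. h x *\<^sub>R Y x) x)"
    using S(3)[OF C1_closure_scaleR[OF h Y]] by simp
  also have "\<dots> = (LINT x:\<Omega>|lborel. h x * divergence (\<lambda>y. k y *\<^sub>R grad s y) x + H x \<bullet> Y x)"
    using divergence_scaleR[OF hH C1_closure_differentiable[OF Y]] \<open>open \<Omega>\<close>
    by (intro set_lebesgue_integral_cong) (auto simp: div_eq)
  also have "\<dots> = (LINT x:\<Omega>|lborel. h x * divergence (\<lambda>y. k y *\<^sub>R grad s y) x)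
      + (LINT x:\<Omega>|lborel. H x \<bullet> Y x)"
    by (rule set_integral_add(2)[OF int int'])
  finally show "(LINT x:\<Omega>|lborel. h x * divergence (\<lambda>y. k y *\<^sub>R grad s y) x)
       = - (LINT x:\<Omega>|lborel. k x * (H x \<bullet> G x))"
    by (simp add: Y_def)
qed

section \<open>Taylor bound for \<open>T_op\<close> and the energy estimate of one substep\<close>

lemma C2_real_DERIV:
  assumes "C2_real q"
  shows "(q has_real_derivative deriv q s) (at s)"
    and "(deriv q has_real_derivative deriv (deriv q) s) (at s)"
  using assms
  by (auto simp: C2_real_def differentiable_on_def DERIV_deriv_iff_real_differentiable)

text \<open>With d = v - u, Taylor gives q'(u) d + q''(t) d^2 / 2 on the left, while the right side
  is q'(u) d + q''(u) d^2 / 2 + A \<tau> d^2. The first-order terms agree, and (q''(t) - q''(u)) / 2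
  is at most L, hence at most A \<tau>.\<close>

lemma T_op_deriv_ge:
  assumes q: "C2_real q" and L: "\<And>z. \<bar>deriv (deriv q) z\<bar> \<le> L" and "L \<le> A * \<tau>"
  shows "q v - q u \<le> T_op (deriv q) u v A \<tau> * (v - u)"
proof (cases "u = v")
  case False
  \<comment> \<open>The sequence of derivatives that \<open>Taylor\<close> expects; only the indices
    0, 1 and 2 matter.\<close>
  define dd where "dd m = (if m = 0 then q else if m = Suc 0 then deriv q else deriv (deriv q))"
    for m :: nat
  have "\<exists>t. (if v < u then v < t \<and> t < u else u < t \<and> t < v) \<and>
      q v = (\<Sum>m<2. dd m u / fact m * (v - u) ^ m) + dd 2 t / fact 2 * (v - u) ^ 2"
    using False C2_real_DERIV[OF q]
    by (intro Taylor[where a = "min u v" and b = "max u v"]) (auto simp: dd_def less_Suc_eq numeral_2_eq_2)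
  then obtain t where t: "q v = q u + deriv q u * (v - u) + deriv (deriv q) t / 2 * (v - u)\<^sup>2"
    by (auto simp: dd_def numeral_2_eq_2)
  have "deriv (deriv q) t / 2 - deriv (deriv q) u / 2 \<le> A * \<tau>"
    using L[of t] L[of u] assms(3) by linarith
  then have "(deriv (deriv q) t / 2 - deriv (deriv q) u / 2) * (v - u)\<^sup>2 \<le> A * \<tau> * (v - u)\<^sup>2"
    by (intro mult_right_mono) auto
  then show ?thesis
    unfolding t T_op_def by (simp add: power2_eq_square field_simps)
qed (simp add: T_op_def)

lemma energy_substep:
  fixes \<Omega> :: "'a::euclidean_space set"
  assumes dom: "divergence_domain \<Omega>"
    and "\<epsilon> > 0" "c > 0"
    and F: "C2_real F" "\<And>z. 0 \<le> F z" "\<And>z. \<bar>deriv (deriv F) z\<bar> \<le> LF" "LF \<le> A * \<tau>"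
    and q: "C2_real q" "\<And>z. \<bar>deriv (deriv q) z\<bar> \<le> Lq" "Lq \<le> B * \<tau>"
    and p: "C2_real p" "\<And>z. 0 \<le> p z"
    and M: "\<And>s. (M has_real_derivative M' s) (at s)" "continuous_on UNIV M'"
    and reg: "C2_closure \<Omega> w" "C2_closure \<Omega> u" "C2_closure \<Omega> v" "C2_closure \<Omega> \<mu>"
    and bc: "neumann \<Omega> u" "neumann \<Omega> v" "neumann \<Omega> \<mu>"
    and evol: "\<And>x. x \<in> \<Omega> \<Longrightarrow> (v x - u x) / c = divergence (\<lambda>y. M (w y) *\<^sub>R grad \<mu> y) x"
    and pot: "\<And>x. x \<in> \<Omega> \<Longrightarrow>
        \<mu> x = - \<epsilon> * divergence (\<lambda>y. p (w y) *\<^sub>R grad (\<lambda>z. (v z + u z) / 2) y) x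
          + 1 / \<epsilon> * p (w x) * T_op (deriv F) (u x) (v x) A \<tau>
          + g_dens \<epsilon> F w x * T_op (deriv q) (u x) (v x) B \<tau>"
  shows "W_energy \<Omega> \<epsilon> F q p w v - W_energy \<Omega> \<epsilon> F q p w u
    \<le> - c * (LINT x:\<Omega>|lborel. M (w x) * (norm (grad \<mu> x))\<^sup>2)"
proof -
  have "open \<Omega>" "bounded \<Omega>"
    using dom by (auto simp: divergence_domain_def)
  note integrable = set_integrable_continuous_closure[OF \<open>open \<Omega>\<close> \<open>bounded \<Omega>\<close>]
  obtain Gu Gv Gm where N: "neumann_gradient \<Omega> u Gu" "neumann_gradient \<Omega> v Gv" "neumann_gradient \<Omega> \<mu> Gm"
    using neumann_gradient_exists[OF \<open>open \<Omega>\<close>] reg bc by metis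
  obtain Gw where w: "C1_closure \<Omega> w" "C1_closure \<Omega> Gw" "\<And>x. x \<in> \<Omega> \<Longrightarrow> grad w x = Gw x"
    using reg(1) unfolding C2_closure_def by metis
  have C1: "C1_closure \<Omega> u" "C1_closure \<Omega> v" "C1_closure \<Omega> \<mu>"
      "C1_closure \<Omega> Gu" "C1_closure \<Omega> Gv" "C1_closure \<Omega> Gm"
    using N by (auto simp: neumann_gradient_def)
  have gd: "GDERIV u x :> Gu x" "GDERIV v x :> Gv x" "GDERIV \<mu> x :> Gm x" if "x \<in> \<Omega>" for x
    using N that by (auto simp: neumann_gradient_def)
  note G = gd[THEN gderiv_grad_eq]
  note cont = C1(1-6)[THEN C1_closure_continuous] w(1,2)[THEN C1_closure_continuous]
  have contC: "continuous_on UNIV r" "continuous_on UNIV (deriv r)" if "C2_real r" for r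
    using that unfolding C2_real_def by (blast intro: differentiable_imp_continuous_on)+
  have pw: "C1_closure \<Omega> (\<lambda>x. p (w x))"
    using C1_closure_compose_real[OF w(1) C2_real_DERIV(1)[OF p(1)] contC(2)[OF p(1)]] .
  have Mw: "C1_closure \<Omega> (\<lambda>x. M (w x))"
    using C1_closure_compose_real[OF w(1) M] .
  have contq: "continuous_on (closure \<Omega>) (\<lambda>x. r (s x))"
    if "C2_real r" "continuous_on (closure \<Omega>) s" for r :: "real \<Rightarrow> real" and s :: "'a \<Rightarrow> real"
    using continuous_on_compose2[OF contC(1)[OF that(1)] that(2)] by auto
  \<comment> \<open>The energy density with gradients replaced by their continuous extensions, so
    that it is integrable.\<close>
  define E where "E G s x = q (s x) * (\<epsilon> / 2 * (norm (Gw x))\<^sup>2 + 1 / \<epsilon> * F (w x))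
      + p (w x) * (\<epsilon> / 2 * (norm (G x))\<^sup>2 + 1 / \<epsilon> * F (s x))" for G :: "'a \<Rightarrow> 'a" and s x
  have E_int: "set_integrable lborel \<Omega> (E Gu u)" "set_integrable lborel \<Omega> (E Gv v)"
    unfolding E_def
    by (rule integrable[OF _ refl], intro continuous_intros cont contq[OF F(1) cont(1)]
        contq[OF F(1) cont(2)] contq[OF F(1) cont(7)] contq[OF q(1) cont(1)]
        contq[OF q(1) cont(2)] contq[OF p(1) cont(7)])+
  have W: "W_energy \<Omega> \<epsilon> F q p w u = (LINT x:\<Omega>|lborel. E Gu u x)"
      "W_energy \<Omega> \<epsilon> F q p w v = (LINT x:\<Omega>|lborel. E Gv v x)"
    using \<open>open \<Omega>\<close> unfolding W_energy_def
    by (auto intro!: set_lebesgue_integral_cong simp: E_def G w(3))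

  let ?dv = "\<lambda>x. v x - u x"
  let ?dM = "divergence (\<lambda>y. M (w y) *\<^sub>R grad \<mu> y)"
  let ?dp = "divergence (\<lambda>y. p (w y) *\<^sub>R grad (\<lambda>z. (v z + u z) / 2) y)"
  have dv_cont: "continuous_on (closure \<Omega>) ?dv" "continuous_on (closure \<Omega>) (\<lambda>x. Gv x - Gu x)"
    by (intro continuous_intros cont)+
  have dv_gd: "GDERIV ?dv x :> Gv x - Gu x" if "x \<in> \<Omega>" for x
    using gd[OF that] by (intro GDERIV_diff)
  note dv = gderiv_imp_C1_closure[OF dv_cont dv_gd]
  \<comment> \<open>The two tests: the potential equation against the increment v - u, the evolution
    equation against \<mu>.\<close>
  note green_p = green_neumann[OF dom dv dv_cont(2) dv_gd pw neumann_gradient_average[OF N(2,1)]]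
  note green_M = green_neumann[OF dom C1(3) cont(6) gd(3) Mw N(3)]
  have dv_mu_int: "set_integrable lborel \<Omega> (\<lambda>x. ?dv x * \<mu> x)"
    by (rule integrable[OF _ refl]) (intro continuous_intros cont)
  have grad_int: "set_integrable lborel \<Omega> (\<lambda>x. p (w x) * ((Gv x - Gu x) \<bullet> ((1 / 2) *\<^sub>R (Gv x + Gu x))))"
    by (rule integrable[OF _ refl]) (intro continuous_intros contq[OF p(1)] cont)

  have "(LINT x:\<Omega>|lborel. E Gv v x) - (LINT x:\<Omega>|lborel. E Gu u x)
      = (LINT x:\<Omega>|lborel. E Gv v x - E Gu u x)"
    using set_integral_diff(2)[OF E_int(2,1)] by simp
  \<comment> \<open>The first bracket is the increment times the nonlinear part of \<mu>, as adding
    \<epsilon> (v - u) \<open>?dp\<close> removes the divergence term. The last summand is the exact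
    increment of the gradient energy; after integration it cancels against that added term.\<close>
  also have "\<dots> \<le> (LINT x:\<Omega>|lborel. (?dv x * \<mu> x + \<epsilon> * (?dv x * ?dp x))
      + \<epsilon> * (p (w x) * ((Gv x - Gu x) \<bullet> ((1 / 2) *\<^sub>R (Gv x + Gu x)))))"
  proof (rule set_integral_mono)
    show "set_integrable lborel \<Omega> (\<lambda>x. E Gv v x - E Gu u x)"
      using E_int by (intro set_integral_diff)
    show "set_integrable lborel \<Omega> (\<lambda>x. (?dv x * \<mu> x + \<epsilon> * (?dv x * ?dp x))
      + \<epsilon> * (p (w x) * ((Gv x - Gu x) \<bullet> ((1 / 2) *\<^sub>R (Gv x + Gu x)))))"
      using dv_mu_int green_p(1) grad_int by (intro set_integral_add set_integrable_mult_right)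
    fix x assume x: "x \<in> \<Omega>"
    let ?TF = "T_op (deriv F) (u x) (v x) A \<tau>" and ?Tq = "T_op (deriv q) (u x) (v x) B \<tau>"
    have "g_dens \<epsilon> F w x * (q (v x) - q (u x)) \<le> g_dens \<epsilon> F w x * (?Tq * ?dv x)"
      using T_op_deriv_ge[OF q] F(2) \<open>\<epsilon> > 0\<close>
      by (intro mult_left_mono) (auto simp: g_dens_def)
    moreover have "1 / \<epsilon> * p (w x) * (F (v x) - F (u x)) \<le> 1 / \<epsilon> * p (w x) * (?TF * ?dv x)"
      using T_op_deriv_ge[OF F(1,3,4)] p(2) \<open>\<epsilon> > 0\<close>
      by (intro mult_left_mono) auto
    moreover have "?dv x * \<mu> x + \<epsilon> * (?dv x * ?dp x)
        = 1 / \<epsilon> * p (w x) * (?TF * ?dv x) + g_dens \<epsilon> F w x * (?Tq * ?dv x)"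
      unfolding pot[OF x] by algebra
    \<comment> \<open>The midpoint identity: (|Gv|^2 - |Gu|^2) / 2 = (Gv - Gu) . (Gv + Gu) /
      2.\<close>
    moreover have "E Gv v x - E Gu u x = g_dens \<epsilon> F w x * (q (v x) - q (u x))
        + 1 / \<epsilon> * p (w x) * (F (v x) - F (u x))
        + \<epsilon> * (p (w x) * ((Gv x - Gu x) \<bullet> ((1 / 2) *\<^sub>R (Gv x + Gu x))))"
      by (simp add: E_def g_dens_def w(3)[OF x] power2_norm_eq_inner inner_diff_left inner_add_right
          inner_commute algebra_simps diff_divide_distrib)
    ultimately show "E Gv v x - E Gu u x \<le> (?dv x * \<mu> x + \<epsilon> * (?dv x * ?dp x))
      + \<epsilon> * (p (w x) * ((Gv x - Gu x) \<bullet> ((1 / 2) *\<^sub>R (Gv x + Gu x))))"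
      by linarith
  qed
  \<comment> \<open>By \<open>green_p\<close> the two \<epsilon>-terms are opposite. Deleting
    \<open>inner_scaleR_right\<close> keeps the integrand in the shape that occurs there.\<close>
  also have "\<dots> = (LINT x:\<Omega>|lborel. ?dv x * \<mu> x)"
    using dv_mu_int green_p grad_int
    by (simp add: set_integral_add set_integrable_mult_right del: inner_scaleR_right)
  also have "\<dots> = (LINT x:\<Omega>|lborel. c * (\<mu> x * ?dM x))"
    using \<open>open \<Omega>\<close> \<open>c > 0\<close> by (intro set_lebesgue_integral_cong) (auto simp: evol[symmetric])
  \<comment> \<open>Here \<mu> is both the test function and the differentiated function, so the
    dissipation appears as a square.\<close>
  also have "\<dots> = - c * (LINT x:\<Omega>|lborel. M (w x) * (Gm x \<bullet> Gm x))"
    using green_M(2) by simp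
  also have "\<dots> = - c * (LINT x:\<Omega>|lborel. M (w x) * (norm (grad \<mu> x))\<^sup>2)"
    using \<open>open \<Omega>\<close>
    by (intro arg_cong[where f = "\<lambda>r. - c * r"] set_lebesgue_integral_cong)
      (auto simp: G power2_norm_eq_inner)
  finally show ?thesis
    by (simp add: W)
qed

section \<open>Combining the three substeps\<close>

lemma W_energy_commute: "W_energy \<Omega> \<epsilon> F \<gamma>1 \<gamma>2 \<psi> \<phi> = W_energy \<Omega> \<epsilon> F \<gamma>2 \<gamma>1 \<phi> \<psi>"
  by (simp add: W_energy_def add.commute)

lemma M2_DERIV:
  "(M2 m2 a has_real_derivative m2 * (real (2 * a) * ((1 + s) / 2) ^ (2 * a - 1) * (1 / 2))) (at s)"
  unfolding M2_def [abs_def] by (auto intro!: derivative_eq_intros)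

theorem theorem4p2:
  fixes \<Omega> :: "'a::euclidean_space set"
    and \<epsilon> \<tau> A1 A2 B1 B2 m1 m2 \<sigma>12 \<sigma>13 \<sigma>23 L_F L_\<gamma>1 L_\<gamma>2 :: real
    and a :: nat
    and F \<gamma>1 \<gamma>2 :: "real \<Rightarrow> real"
    and \<psi>0 \<phi>0 \<phi>h \<psi>1 \<phi>1 \<mu>\<phi>_1 \<mu>\<psi> \<mu>\<phi>_3 :: "'a \<Rightarrow> real"
  assumes dim: "DIM('a) = 2 \<or> DIM('a) = 3"
    and domain: "divergence_domain \<Omega>"
    and params: "\<epsilon> > 0" "\<tau> > 0" "A1 > 0" "A2 > 0" "B1 > 0" "B2 > 0"
    and mobility: "m1 > 0" "m2 > 0" "a > 0"
    and tension: "\<sigma>12 > 0" "\<sigma>13 > 0" "\<sigma>23 > 0"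
    and F: "regularization F_model F L_F"
    and \<gamma>1: "regularization (gamma1_model \<epsilon> \<sigma>12 \<sigma>13) \<gamma>1 L_\<gamma>1"
    and \<gamma>2: "regularization (gamma2_model \<epsilon> \<sigma>23) \<gamma>2 L_\<gamma>2"
    and regular:
      "C2_closure \<Omega> \<psi>0" "C2_closure \<Omega> \<phi>0" "C2_closure \<Omega> \<phi>h" "C2_closure \<Omega> \<psi>1" "C2_closure \<Omega> \<phi>1"
      "C2_closure \<Omega> \<mu>\<phi>_1" "C2_closure \<Omega> \<mu>\<psi>" "C2_closure \<Omega> \<mu>\<phi>_3"
    and initial_bc: "neumann \<Omega> \<psi>0" "neumann \<Omega> \<phi>0"
    and step1: "\<And>x. x \<in> \<Omega> \<Longrightarrow>
        (\<phi>h x - \<phi>0 x) / (\<tau> / 2) = divergence (\<lambda>y. M2 m2 a (\<psi>0 y) *\<^sub>R grad \<mu>\<phi>_1 y) x"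
      "\<And>x. x \<in> \<Omega> \<Longrightarrow>
        \<mu>\<phi>_1 x = - \<epsilon> * divergence (\<lambda>y. \<gamma>2 (\<psi>0 y) *\<^sub>R grad (\<lambda>z. (\<phi>h z + \<phi>0 z) / 2) y) x
          + 1 / \<epsilon> * \<gamma>2 (\<psi>0 x) * T_op (deriv F) (\<phi>0 x) (\<phi>h x) A1 \<tau>
          + g_dens \<epsilon> F \<psi>0 x * T_op (deriv \<gamma>1) (\<phi>0 x) (\<phi>h x) B1 \<tau>"
    and step2: "\<And>x. x \<in> \<Omega> \<Longrightarrow>
        (\<psi>1 x - \<psi>0 x) / \<tau> = divergence (\<lambda>y. m1 *\<^sub>R grad \<mu>\<psi> y) x"
      "\<And>x. x \<in> \<Omega> \<Longrightarrow>
        \<mu>\<psi> x = - \<epsilon> * divergence (\<lambda>y. \<gamma>1 (\<phi>h y) *\<^sub>R grad (\<lambda>z. (\<psi>1 z + \<psi>0 z) / 2) y) x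
          + 1 / \<epsilon> * \<gamma>1 (\<phi>h x) * T_op (deriv F) (\<psi>0 x) (\<psi>1 x) A2 \<tau>
          + g_dens \<epsilon> F \<phi>h x * T_op (deriv \<gamma>2) (\<psi>0 x) (\<psi>1 x) B2 \<tau>"
    and step3: "\<And>x. x \<in> \<Omega> \<Longrightarrow>
        (\<phi>1 x - \<phi>h x) / (\<tau> / 2) = divergence (\<lambda>y. M2 m2 a (\<psi>1 y) *\<^sub>R grad \<mu>\<phi>_3 y) x"
      "\<And>x. x \<in> \<Omega> \<Longrightarrow>
        \<mu>\<phi>_3 x = - \<epsilon> * divergence (\<lambda>y. \<gamma>2 (\<psi>1 y) *\<^sub>R grad (\<lambda>z. (\<phi>1 z + \<phi>h z) / 2) y) x
          + 1 / \<epsilon> * \<gamma>2 (\<psi>1 x) * T_op (deriv F) (\<phi>h x) (\<phi>1 x) A1 \<tau>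
          + g_dens \<epsilon> F \<psi>1 x * T_op (deriv \<gamma>1) (\<phi>h x) (\<phi>1 x) B1 \<tau>"
    and bc: "neumann \<Omega> \<phi>h" "neumann \<Omega> \<psi>1" "neumann \<Omega> \<phi>1"
      "neumann \<Omega> \<mu>\<phi>_1" "neumann \<Omega> \<mu>\<psi>" "neumann \<Omega> \<mu>\<phi>_3"
    and time_step: "\<tau> \<ge> Max {L_F / A1, L_\<gamma>1 / B1, L_F / A2, L_\<gamma>2 / B2}"
  shows "W_energy \<Omega> \<epsilon> F \<gamma>1 \<gamma>2 \<psi>1 \<phi>1 \<le> W_energy \<Omega> \<epsilon> F \<gamma>1 \<gamma>2 \<psi>0 \<phi>0 \<and>
    W_energy \<Omega> \<epsilon> F \<gamma>1 \<gamma>2 \<psi>1 \<phi>1 - W_energy \<Omega> \<epsilon> F \<gamma>1 \<gamma>2 \<psi>0 \<phi>0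
      \<le> - \<tau> / 2 * (LINT x:\<Omega>|lborel. M2 m2 a (\<psi>0 x) * (norm (grad \<mu>\<phi>_1 x))^2)
        - \<tau> * (LINT x:\<Omega>|lborel. m1 * (norm (grad \<mu>\<psi> x))^2)
        - \<tau> / 2 * (LINT x:\<Omega>|lborel. M2 m2 a (\<psi>1 x) * (norm (grad \<mu>\<phi>_3 x))^2)"
proof -
  have L: "L_F \<le> A1 * \<tau>" "L_\<gamma>1 \<le> B1 * \<tau>" "L_F \<le> A2 * \<tau>" "L_\<gamma>2 \<le> B2 * \<tau>"
    using time_step params by (auto simp: divide_le_eq mult.commute)
  have R: "C2_real F" "\<And>z. 0 \<le> F z" "\<And>z. \<bar>deriv (deriv F) z\<bar> \<le> L_F"
      "C2_real \<gamma>1" "\<And>z. 0 \<le> \<gamma>1 z" "\<And>z. \<bar>deriv (deriv \<gamma>1) z\<bar> \<le> L_\<gamma>1"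
      "C2_real \<gamma>2" "\<And>z. 0 \<le> \<gamma>2 z" "\<And>z. \<bar>deriv (deriv \<gamma>2) z\<bar> \<le> L_\<gamma>2"
    using F \<gamma>1 \<gamma>2 by (auto simp: regularization_def)
  have half: "\<tau> / 2 > 0"
    using params by simp
  have M2_cont: "continuous_on UNIV
      (\<lambda>s. m2 * (real (2 * a) * ((1 + s) / 2) ^ (2 * a - 1) * (1 / 2)))"
    by (intro continuous_intros) auto
  have s1: "W_energy \<Omega> \<epsilon> F \<gamma>1 \<gamma>2 \<psi>0 \<phi>h - W_energy \<Omega> \<epsilon> F \<gamma>1 \<gamma>2 \<psi>0 \<phi>0
      \<le> - (\<tau> / 2) * (LINT x:\<Omega>|lborel. M2 m2 a (\<psi>0 x) * (norm (grad \<mu>\<phi>_1 x))\<^sup>2)"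
    by (rule energy_substep[OF domain params(1) half R(1-3) L(1) R(4,6) L(2) R(7,8) M2_DERIV M2_cont
          regular(1,2,3,6) initial_bc(2) bc(1,4) step1])
  \<comment> \<open>Now \<open>\<phi>h\<close> is frozen, so both the fields and the coefficients
    trade places in the energy. The constant mobility enters as a function with derivative
    0.\<close>
  have s2: "W_energy \<Omega> \<epsilon> F \<gamma>2 \<gamma>1 \<phi>h \<psi>1 - W_energy \<Omega> \<epsilon> F \<gamma>2 \<gamma>1 \<phi>h \<psi>0
      \<le> - \<tau> * (LINT x:\<Omega>|lborel. m1 * (norm (grad \<mu>\<psi> x))\<^sup>2)"
    by (rule energy_substep[OF domain params(1,2) R(1-3) L(3) R(7,9) L(4) R(4,5) DERIV_const
          continuous_on_const regular(3,1,4,7) initial_bc(1) bc(2,5) step2])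
  have s3: "W_energy \<Omega> \<epsilon> F \<gamma>1 \<gamma>2 \<psi>1 \<phi>1 - W_energy \<Omega> \<epsilon> F \<gamma>1 \<gamma>2 \<psi>1 \<phi>h
      \<le> - (\<tau> / 2) * (LINT x:\<Omega>|lborel. M2 m2 a (\<psi>1 x) * (norm (grad \<mu>\<phi>_3 x))\<^sup>2)"
    by (rule energy_substep[OF domain params(1) half R(1-3) L(1) R(4,6) L(2) R(7,8) M2_DERIV M2_cont
          regular(4,3,5,8) bc(1,3,6) step3])
  \<comment> \<open>No integrability has to be shown: the integral of a nonnegative function is
    nonnegative in any case, being 0 if the function is not integrable.\<close>
  have nonneg: "0 \<le> (LINT x:\<Omega>|lborel. k x * (norm (grad s x))\<^sup>2)" if "\<And>x. 0 \<le> k x"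
    for k s :: "'a \<Rightarrow> real"
    using that by (auto simp: set_lebesgue_integral_def intro!: integral_nonneg)
  \<comment> \<open>The exponent \<open>2 * a\<close> is even, so the sign is right also for
    arguments below -1.\<close>
  have M2_nonneg: "0 \<le> M2 m2 a z" for z
    using mobility by (simp add: M2_def power_mult)
  have "0 \<le> \<tau> / 2 * (LINT x:\<Omega>|lborel. M2 m2 a (\<psi>0 x) * (norm (grad \<mu>\<phi>_1 x))\<^sup>2)"
      "0 \<le> \<tau> * (LINT x:\<Omega>|lborel. m1 * (norm (grad \<mu>\<psi> x))\<^sup>2)"
      "0 \<le> \<tau> / 2 * (LINT x:\<Omega>|lborel. M2 m2 a (\<psi>1 x) * (norm (grad \<mu>\<phi>_3 x))\<^sup>2)"
    using params mobility M2_nonneg by (intro mult_nonneg_nonneg nonneg; simp)+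
  \<comment> \<open>The energies at the two intermediate states cancel in the sum of the three
    estimates; dropping the nonnegative dissipation gives stability.\<close>
  then show ?thesis
    using s1 s2 s3
      W_energy_commute[of \<Omega> \<epsilon> F \<gamma>2 \<gamma>1 \<phi>h \<psi>1] W_energy_commute[of \<Omega> \<epsilon> F \<gamma>2 \<gamma>1 \<phi>h \<psi>0]
    by simp
qed

end
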